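(* Let $p$ and $q$ be two distributions on a discrete domain. Let $\pi\in(0,1/2]$ and $\lambda\in(0,1/2]$. Then $$\mathrm{JS}_\pi(p,q)\le\frac{32\,e^{2\lambda\log(1/\pi)}\,\pi}{\lambda}\,\mathcal H_{1-\lambda}(p,q).$$ In particular, for $\lambda=\frac{0.5\log2}{\log(1/\pi)}$, we have $$\left\lceil\frac{3}{16}\,\frac{\pi\log(1/\pi)}{\mathrm{JS}_\pi(p,q)}\right\rceil\le\left\lceil\frac{2}{\mathcal H_{1-\lambda}(p,q)}\right\rceil\le\left\lceil\frac{256}{\log2}\,\frac{\pi\log(1/\pi)}{\mathrm{JS}_\pi(p,q)}\right\rceil.$$
   Context: The skewed Jensen–Shannon divergence is $\mathrm{JS}_\pi(p,q)=\pi\,\mathrm{KL}(p,\pi p+(1-\pi)q)+(1-\pi)\,\mathrm{KL}(q,\pi p+(1-\pi)q)$ with $\mathrm{KL}(p,q)=\sum_i p_i\log(p_i/q_i)$. For $\lambda\in[0,1]$, $\mathcal H_\lambda(p,q)=1-\sum_i p_i^\lambda q_i^{1-\lambda}$. Logarithms are natural; $x/0=+\infty$ for $x>0$ (relevant only when $p=q$). *)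

theory Defs
  imports "HOL-Probability.Probability"
begin

text \<open>
  A distribution on a discrete domain is a \<^typ>\<open>'a pmf\<close>; its support is countable, finite or infinite.
\<close>

definition mix_pmf :: "real \<Rightarrow> 'a pmf \<Rightarrow> 'a pmf \<Rightarrow> 'a pmf" where
  "mix_pmf w p q = bind_pmf (bernoulli_pmf w) (\<lambda>b. if b then p else q)"

lemma pmf_mix_pmf:
  assumes "0 \<le> w" "w \<le> 1"
  shows "pmf (mix_pmf w p q) i = w * pmf p i + (1 - w) * pmf q i"
  using assms by (simp add: mix_pmf_def pmf_bind)

text \<open>
  Terms with \<^prop>\<open>pmf p i = 0\<close> vanish, as usual. The value is \<open>\<infinity>\<close> if \<open>p\<close> charges a point of mass
  zero under \<open>q\<close>. The negative parts of the terms are always summable, since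
  \<open>x * ln (y / x) \<le> y - x\<close>, so a failure of summability also means the value \<open>\<infinity>\<close>.
\<close>

definition KL :: "'a pmf \<Rightarrow> 'a pmf \<Rightarrow> ereal" where
  "KL p q =
    (if set_pmf p \<subseteq> set_pmf q \<and> (\<lambda>i. pmf p i * ln (pmf p i / pmf q i)) summable_on UNIV
     then ereal (\<Sum>\<^sub>\<infinity>i. pmf p i * ln (pmf p i / pmf q i))
     else \<infinity>)"

definition JS :: "real \<Rightarrow> 'a pmf \<Rightarrow> 'a pmf \<Rightarrow> ereal" where
  "JS w p q = ereal w * KL p (mix_pmf w p q) + ereal (1 - w) * KL q (mix_pmf w p q)"

text \<open>
  At the endpoints \<open>l = 0\<close> and \<open>l = 1\<close> the convention \<^prop>\<open>(0::real) powr 0 = 0\<close> applies, that is, the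
  sum only ranges over the common support; for \<open>0 < l < 1\<close> no convention is involved.
\<close>

definition Hell :: "real \<Rightarrow> 'a pmf \<Rightarrow> 'a pmf \<Rightarrow> real" where
  "Hell l p q = 1 - (\<Sum>\<^sub>\<infinity>i. pmf p i powr l * pmf q i powr (1 - l))"

text \<open>
  Ceilings are taken of extended reals because the quotients have value \<open>\<infinity>\<close> for \<^prop>\<open>p = q\<close>:
  division on \<^typ>\<open>ereal\<close> satisfies \<open>x / 0 = \<infinity>\<close> for \<open>x > 0\<close>.
\<close>

definition ereal_ceiling :: "ereal \<Rightarrow> ereal" where
  "ereal_ceiling x = (if \<bar>x\<bar> = \<infinity> then x else ereal (of_int \<lceil>real_of_ereal x\<rceil>))"

end

theory Submission
  imports Defs
begin

text \<open>
  Both divergences are sums of 1-homogeneous functions of the pairs \<open>(p i, q i)\<close>, so they are compared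
  termwise, as functions of \<open>t = p i / q i\<close> that vanish together with their derivatives at \<open>t = 1\<close>.
  With \<open>m = w t + 1 - w\<close> the derivatives are \<open>w ln (t / m)\<close> for Jensen--Shannon and
  \<open>(1 - l) (1 - t powr - l)\<close> for Hellinger. As \<open>t / m\<close> lies between \<open>1\<close> and \<open>t\<close> and is at most \<open>1 / w\<close>,
  the former is at most a multiple of the latter in absolute value. Conversely, \<open>l (1 - t + t ln t)\<close>
  dominates the Hellinger term and serves as the intermediate function for \<open>t \<le> 1\<close>, while for
  \<open>t \<ge> 1\<close> the quantity \<open>ln (t / m)\<close> is at least a quarter of \<open>min (ln t) (ln (1 / w))\<close>.
\<close>

section \<open>The two summands: homogeneity and derivatives\<close>

definition js_term :: "real \<Rightarrow> real \<Rightarrow> real \<Rightarrow> real" where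
  "js_term w a b =
     w * (a * ln (a / (w * a + (1 - w) * b))) + (1 - w) * (b * ln (b / (w * a + (1 - w) * b)))"

text \<open>
  The parameter \<open>l\<close> is the exponent of the second argument, so this is the term of \<open>Hell (1 - l)\<close>. The
  linear part sums to \<open>1\<close> and makes every term nonnegative.
\<close>

definition hell_term :: "real \<Rightarrow> real \<Rightarrow> real \<Rightarrow> real" where
  "hell_term l a b = (1 - l) * a + l * b - a powr (1 - l) * b powr l"

lemma js_term_scale:
  assumes "c > 0"
  shows "js_term w (c * a) (c * b) = c * js_term w a b"
proof -
  have eq: "w * (c * a) + (1 - w) * (c * b) = c * (w * a + (1 - w) * b)"
    by (simp add: algebra_simps)
  have "c * x / (c * (w * a + (1 - w) * b)) = x / (w * a + (1 - w) * b)" for x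
    using assms by simp
  then show ?thesis
    unfolding js_term_def eq by (simp add: distrib_left mult_ac)
qed

lemma hell_term_scale:
  assumes "c > 0" "a \<ge> 0" "b \<ge> 0"
  shows "hell_term l (c * a) (c * b) = c * hell_term l a b"
proof -
  have "c powr (1 - l) * c powr l = c"
    using assms by (simp add: powr_add [symmetric])
  then have "(c * a) powr (1 - l) * (c * b) powr l = c * (a powr (1 - l) * b powr l)"
    using assms by (simp add: powr_mult mult_ac)
  then show ?thesis
    unfolding hell_term_def by (simp add: algebra_simps)
qed

text \<open>By the mean value theorem between \<open>1\<close> and \<open>t\<close>:
  \<open>F\<close> falls to its zero at \<open>1\<close> and rises afterwards. Comparing two terms
  thus reduces to comparing their derivatives on each side of \<open>1\<close>.\<close>

lemma nonneg_if_deriv_signs: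
  fixes F F' :: "real \<Rightarrow> real"
  assumes F1: "F 1 = 0"
    and deriv: "\<And>t. t > 0 \<Longrightarrow> (F has_real_derivative F' t) (at t)"
    and left: "\<And>t. 0 < t \<Longrightarrow> t < 1 \<Longrightarrow> F' t \<le> 0"
    and right: "\<And>t. 1 < t \<Longrightarrow> F' t \<ge> 0"
    and "t > 0"
  shows "F t \<ge> 0"
proof (cases t "1 :: real" rule: linorder_cases)
  case less
  then obtain z where "t < z" "z < 1" "F 1 - F t = (1 - t) * F' z"
    using MVT2 [of t 1 F F'] deriv \<open>t > 0\<close> by force
  then show ?thesis
    using left [of z] \<open>t > 0\<close> F1 less mult_nonneg_nonpos [of "1 - t" "F' z"] by auto
next
  case greater
  then obtain z where "1 < z" "z < t" "F t - F 1 = (t - 1) * F' z"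
    using MVT2 [of 1 t F F'] deriv by force
  then show ?thesis
    using right [of z] F1 greater by simp
qed (simp add: F1)

lemma mix_pos:
  fixes w t :: real
  assumes "0 < w" "w < 1" "t > 0"
  shows "w * t + (1 - w) > 0"
  using assms by (simp add: add_pos_pos)

text \<open>With \<open>m = w * t + (1 - w)\<close> the term is
  \<open>w * t * ln t - m * ln m\<close>; the constants \<open>w\<close> produced by the two product
  rules cancel.\<close>

lemma js_term_deriv:
  assumes "0 < w" "w < 1" "t > 0"
  shows "((\<lambda>t. js_term w t 1) has_real_derivative w * ln (t / (w * t + (1 - w)))) (at t)"
proof -
  let ?m = "w * t + (1 - w)"
  have m: "?m > 0" using mix_pos assms by simp
  have eq: "js_term w s 1 = w * s * ln s - (w * s + (1 - w)) * ln (w * s + (1 - w))" if "s > 0" for s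
    using that mix_pos [of w s] assms by (simp add: js_term_def ln_div algebra_simps)
  have "((\<lambda>s. w * s * ln s - (w * s + (1 - w)) * ln (w * s + (1 - w))) has_real_derivative
          w * ln (t / ?m)) (at t)"
    using m assms by (auto intro!: derivative_eq_intros simp: ln_div divide_simps) (simp add: algebra_simps)
  \<comment> \<open>The closed form holds only for positive \<open>s\<close>; these form a
    neighbourhood of \<open>t\<close>, so the derivative carries over.\<close>
  then show ?thesis
    by (rule DERIV_cong_ev [THEN iffD1, rotated -1, OF _])
      (use assms eq in \<open>auto intro!: eventually_mono [OF eventually_nhds_in_open [of "{0<..}"]]\<close>)
qed

lemma hell_term_deriv:
  assumes "t > 0"
  shows "((\<lambda>t. hell_term l t 1) has_real_derivative (1 - l) * (1 - t powr - l)) (at t)"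
  unfolding hell_term_def using assms
  by (auto intro!: derivative_eq_intros simp: algebra_simps)

text \<open>Both are \<open>1 + x \<le> exp x\<close>, at \<open>x = - (l * ln t)\<close> and at
  \<open>x = l * ln t\<close>, the latter multiplied by \<open>t powr - l\<close>.\<close>

lemma one_minus_powr_bounds:
  fixes l t :: real
  assumes "t > 0"
  shows "1 - t powr - l \<le> l * ln t" "t powr - l * (l * ln t) \<le> 1 - t powr - l"
proof -
  have e: "t powr - l = exp (- (l * ln t))"
    using assms by (simp add: powr_def)
  show "1 - t powr - l \<le> l * ln t"
    using exp_ge_add_one_self [of "- (l * ln t)"] by (simp add: e)
  have "exp (- (l * ln t)) * (1 + l * ln t) \<le> exp (- (l * ln t)) * exp (l * ln t)"
    by (intro mult_left_mono exp_ge_add_one_self) auto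
  then show "t powr - l * (l * ln t) \<le> 1 - t powr - l"
    by (simp add: e exp_minus algebra_simps)
qed

text \<open>This is the weighted inequality of arithmetic and geometric means.\<close>

lemma hell_term_nonneg:
  assumes "0 < l" "l < 1" "a \<ge> 0" "b \<ge> 0"
  shows "hell_term l a b \<ge> 0"
  using Youngs_inequality_0 [of "1 - l" l a b] assms
  by (cases "a = 0 \<or> b = 0") (auto simp: hell_term_def)

section \<open>Bounding Jensen-Shannon terms by Hellinger terms\<close>

text \<open>The derivatives are compared. For \<open>t < 1\<close> the ratio \<open>t / m\<close> is
  at least \<open>t\<close>, which already suffices with factor \<open>w / l\<close>; for
  \<open>t > 1\<close> the bound \<open>t / m \<le> 1 / w\<close> costs the factor
  \<open>w powr - l\<close>.\<close>

lemma js_term_le_hell_term_aux: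
  assumes w: "0 < w" "w < 1" and l: "0 < l" "l \<le> 1/2" and t: "t > 0"
  shows "js_term w t 1 \<le> 2 * w powr - l * w / l * hell_term l t 1"
proof -
  let ?C = "2 * w powr - l * w / l"
  let ?u = "\<lambda>t. t / (w * t + (1 - w))"
  have wl: "w powr - l \<ge> 1"
    using w l powr_mono2' [of "-l" w 1] by simp
  \<comment> \<open>The 2 in \<open>?C\<close> compensates for
    \<open>1 - l \<ge> 1/2\<close>.\<close>
  have C: "?C * (1 - l) \<ge> w powr - l * w / l"
  proof -
    have "w powr - l * w / l * 1 \<le> w powr - l * w / l * (2 * (1 - l))"
      using w l by (intro mult_left_mono) auto
    also have "\<dots> = ?C * (1 - l)" by simp
    finally show ?thesis by simp
  qed
  have "0 \<le> ?C * hell_term l t 1 - js_term w t 1"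
  proof (rule nonneg_if_deriv_signs [OF _ _ _ _ t])
    show "?C * hell_term l 1 1 - js_term w 1 1 = 0"
      by (simp add: hell_term_def js_term_def)
  next
    fix t :: real assume "t > 0"
    then show "((\<lambda>t. ?C * hell_term l t 1 - js_term w t 1) has_real_derivative
        ?C * ((1 - l) * (1 - t powr - l)) - w * ln (?u t)) (at t)"
      by (intro DERIV_diff DERIV_cmult hell_term_deriv js_term_deriv w)
  next
    fix t :: real assume t: "0 < t" "t < 1"
    have "w * t + (1 - w) \<le> 1"
      using w t by (simp add: mult_left_le)
    then have "t \<le> ?u t"
      using mix_pos [of w t] w t by (simp add: field_simps mult_left_le)
    then have "ln t \<le> ln (?u t)"
      using t by simp
    have "1 - t powr - l \<le> l * ln t"
      using one_minus_powr_bounds t by simp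
    moreover have "l * ln t \<le> 0"
      using l t by (simp add: mult_nonneg_nonpos)
    ultimately have np: "1 - t powr - l \<le> 0" by linarith
    have "?C * ((1 - l) * (1 - t powr - l)) \<le> (w / l) * (1 - t powr - l)"
    proof -
      have "w / l \<le> ?C * (1 - l)"
        using C wl w l by (smt (verit, best) divide_right_mono mult_le_cancel_right1)
      then show ?thesis
        using mult_right_mono_neg np by (metis mult.assoc)
    qed
    also have "\<dots> \<le> (w / l) * (l * ln t)"
      using one_minus_powr_bounds [OF t(1)] w l by (intro mult_left_mono) auto
    also have "\<dots> \<le> w * ln (?u t)"
      using \<open>ln t \<le> ln (?u t)\<close> w l by simp
    finally show "?C * ((1 - l) * (1 - t powr - l)) - w * ln (?u t) \<le> 0"
      by simp
  next
    fix t :: real assume t: "1 < t"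
    have m: "w * t + (1 - w) > 0"
      using mix_pos w t by simp
    have "w * t + (1 - w) \<ge> 1"
      using w t by simp
    then have ut: "?u t \<le> t"
      using t m by (simp add: field_simps)
    have "t \<ge> w * t + (1 - w)"
      using w t mult_left_mono [of 1 t "1 - w"] by (simp add: algebra_simps)
    then have u1: "?u t \<ge> 1"
      using m by simp
    have u2: "?u t \<le> 1 / w"
      using w m by (simp add: field_simps)
    \<comment> \<open>The second exponential bound loses a factor \<open>x powr - l\<close>. It is
      applied to \<open>?u t\<close> instead of \<open>t\<close>, because
      \<open>?u t \<le> 1 / w\<close> keeps that factor above \<open>w powr l\<close>; monotonicity
      then passes from \<open>?u t\<close> to \<open>t\<close>.\<close>
    have "w powr l * (l * ln (?u t)) \<le> (?u t) powr - l * (l * ln (?u t))"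
    proof (intro mult_right_mono)
      have "(1 / w) powr - l \<le> (?u t) powr - l"
        using u1 u2 l by (intro powr_mono2') auto
      then show "w powr l \<le> (?u t) powr - l"
        using w by (simp add: powr_divide powr_minus field_simps)
    qed (use l u1 in \<open>auto simp: ln_ge_zero\<close>)
    also have "\<dots> \<le> 1 - (?u t) powr - l"
      using one_minus_powr_bounds u1 by simp
    also have "\<dots> \<le> 1 - t powr - l"
      using powr_mono2' [of "-l" "?u t" t] u1 ut l by simp
    finally have *: "w powr l * (l * ln (?u t)) \<le> 1 - t powr - l" .
    have ww: "w powr - l * w powr l = 1"
      using w by (simp add: powr_add [symmetric])
    have "w * ln (?u t) = (w powr - l * w powr l) * (w / l * (l * ln (?u t)))"
      using l by (simp add: ww)
    also have "\<dots> = (w powr - l * w / l) * (w powr l * (l * ln (?u t)))"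
      by simp
    also have "\<dots> \<le> (w powr - l * w / l) * (1 - t powr - l)"
      using * w l by (intro mult_left_mono) auto
    also have "\<dots> \<le> ?C * (1 - l) * (1 - t powr - l)"
      using C t l powr_mono2' [of "-l" 1 t] by (intro mult_right_mono) auto
    finally show "0 \<le> ?C * ((1 - l) * (1 - t powr - l)) - w * ln (?u t)"
      by (simp add: mult.assoc)
  qed
  then show ?thesis by simp
qed

text \<open>Homogeneity reduces positive pairs to \<open>b = 1\<close>. The cases
  \<open>a = 0\<close> and \<open>b = 0\<close>, the limits \<open>t = 0\<close> and
  \<open>t = \<infinity>\<close>, are computed directly.\<close>

lemma js_term_le_hell_term:
  assumes w: "0 < w" "w < 1" and l: "0 < l" "l \<le> 1/2" and ab: "a \<ge> 0" "b \<ge> 0"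
  shows "js_term w a b \<le> 2 * w powr - l * w / l * hell_term l a b"
proof -
  have wl: "w powr - l \<ge> 1"
    using w l powr_mono2' [of "-l" w 1] by simp
  consider "a > 0" "b > 0" | "a = 0" | "b = 0" "a > 0"
    using ab by force
  then show ?thesis
  proof cases
    case 1
    have "js_term w a b = b * js_term w (a / b) 1"
      using js_term_scale [of b w "a / b" 1] 1 by simp
    also have "\<dots> \<le> b * (2 * w powr - l * w / l * hell_term l (a / b) 1)"
      using 1 by (intro mult_left_mono js_term_le_hell_term_aux w l) auto
    also have "\<dots> = 2 * w powr - l * w / l * hell_term l a b"
      using hell_term_scale [of b "a / b" 1 l] 1 by simp
    finally show ?thesis .
  next
    case 2
    have "ln (1 / (1 - w)) \<le> 1 / (1 - w) - 1"
      using w by (intro ln_le_minus_one) auto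
    then have "(1 - w) * ln (1 / (1 - w)) \<le> (1 - w) * (1 / (1 - w) - 1)"
      using w by (intro mult_left_mono) auto
    also have "\<dots> = w" using w by (simp add: field_simps)
    also have "w \<le> 2 * w powr - l * w"
      using wl w by simp
    finally have "(1 - w) * ln (1 / (1 - w)) \<le> 2 * w powr - l * w" .
    then have "b * ((1 - w) * ln (1 / (1 - w))) \<le> b * (2 * w powr - l * w)"
      using ab by (intro mult_left_mono) auto
    moreover have "js_term w 0 b = b * ((1 - w) * ln (1 / (1 - w)))"
      by (cases "b = 0") (simp_all add: js_term_def)
    moreover have "2 * w powr - l * w / l * hell_term l 0 b = b * (2 * w powr - l * w)"
      using l by (simp add: hell_term_def)
    ultimately show ?thesis
      using 2 by simp
  next
    case 3
    \<comment> \<open>For \<open>b = 0\<close> the terms are \<open>w * a * ln (1 / w)\<close> and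
      \<open>(1 - l) * a\<close>, so it remains to bound \<open>l * ln (1 / w)\<close> by
      \<open>2 * (1 - l) * w powr - l\<close>.\<close>
    have "l * ln (1 / w) = ln (w powr - l)"
      using w by (simp add: ln_powr ln_div)
    also have "\<dots> \<le> w powr - l"
      using ln_le_minus_one [of "w powr - l"] w by simp
    also have "\<dots> \<le> w powr - l * (2 * (1 - l))"
      using l mult_left_mono [of 1 "2 * (1 - l)" "w powr - l"] by simp
    finally have "w * a / l * (l * ln (1 / w)) \<le> w * a / l * (w powr - l * (2 * (1 - l)))"
      using w l 3 by (intro mult_left_mono) auto
    moreover have "w * a / l * (l * ln (1 / w)) = js_term w a b"
      using 3 l w by (simp add: js_term_def)
    moreover have "w * a / l * (w powr - l * (2 * (1 - l))) = 2 * w powr - l * w / l * hell_term l a b"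
      using 3 by (simp add: hell_term_def)
    ultimately show ?thesis
      by metis
  qed
qed


section \<open>Bounding Hellinger terms by Jensen-Shannon terms\<close>

text \<open>The difference of the two sides is
  \<open>t * (l * ln t - (1 - t powr - l))\<close>.\<close>

lemma hell_term_le:
  assumes "t > 0"
  shows "hell_term l t 1 \<le> l * (1 - t + t * ln t)"
proof -
  have "t powr (1 - l) = t * t powr - l"
    using powr_add [of t 1 "-l"] assms by simp
  moreover have "t * (1 - t powr - l) \<le> t * (l * ln t)"
    using one_minus_powr_bounds [OF assms] assms by (intro mult_left_mono) auto
  ultimately show ?thesis
    by (simp add: hell_term_def algebra_simps)
qed

text \<open>For \<open>t \<le> 1\<close> the mixture decreases in \<open>w\<close>, and at
  \<open>w = 1/2\<close> the claim is the inequality of arithmetic and geometric means. It yields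
  \<open>t / m \<le> sqrt t\<close>.\<close>

lemma sqrt_le_mix:
  fixes w t :: real
  assumes w: "0 < w" "w \<le> 1/2" and t: "0 < t" "t \<le> 1"
  shows "sqrt t \<le> w * t + (1 - w)"
proof -
  have "sqrt t \<le> (t + 1) / 2"
    using arith_geo_mean_sqrt [of t 1] t by simp
  also have "\<dots> = 1/2 * t + (1 - 1/2)"
    by simp
  also have "\<dots> \<le> w * t + (1 - w)"
    using mult_left_mono [of t 1 "1/2 - w"] w t by (simp add: algebra_simps)
  finally show ?thesis .
qed

text \<open>Both sides vanish at \<open>1\<close>, and below \<open>1\<close> the derivative
  \<open>w * ln (t / m)\<close> is at most \<open>w / 2 * ln t\<close>, because
  \<open>t / m \<le> sqrt t\<close>.\<close>

lemma js_term_ge_left: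
  assumes w: "0 < w" "w \<le> 1/2" and t: "0 < t" "t \<le> 1"
  shows "w / 2 * (1 - t + t * ln t) \<le> js_term w t 1"
proof -
  let ?F = "\<lambda>t. js_term w t 1 - w / 2 * (1 - t + t * ln t)"
  let ?F' = "\<lambda>t. w * ln (t / (w * t + (1 - w))) - w / 2 * ln t"
  have deriv: "(?F has_real_derivative ?F' s) (at s)" if "s > 0" for s
  proof (intro DERIV_diff DERIV_cmult js_term_deriv)
    show "((\<lambda>t. 1 - t + t * ln t) has_real_derivative ln s) (at s)"
      using that by (auto intro!: derivative_eq_intros)
  qed (use w that in auto)
  show ?thesis
  proof (cases "t = 1")
    case False
    then obtain z where z: "t < z" "z < 1" "?F 1 - ?F t = (1 - t) * ?F' z"
      using MVT2 [of t 1 ?F ?F'] deriv t by force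
    have "z / (w * z + (1 - w)) \<le> z / sqrt z"
      using sqrt_le_mix [of w z] w z t by (intro divide_left_mono) (auto intro!: mult_pos_pos mix_pos)
    also have "\<dots> = sqrt z"
      using z t by (simp add: real_div_sqrt)
    finally have "ln (z / (w * z + (1 - w))) \<le> ln (sqrt z)"
      using z t w mix_pos [of w z] by simp
    also have "\<dots> = ln z / 2"
      using z t by (simp add: ln_sqrt)
    finally have "w * ln (z / (w * z + (1 - w))) \<le> w * (ln z / 2)"
      using w by (intro mult_left_mono) auto
    then have "?F' z \<le> 0" by simp
    then have "?F 1 - ?F t \<le> 0"
      using z t by (simp add: mult_nonneg_nonpos)
    then show ?thesis by (simp add: js_term_def)
  qed (simp add: js_term_def)
qed

text \<open>The left side is the mixture at \<open>t = 1 / w\<close>. From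
  \<open>w * (2 - w) = 1 - (1 - w)^2 \<le> 3/4\<close> one gets
  \<open>w^3 * (2 - w)^4 \<le> 27/64 * 2 < 1\<close>; then take fourth roots.\<close>

lemma mix_at_inverse_le:
  fixes w :: real
  assumes w: "0 < w" "w \<le> 1/2"
  shows "2 - w \<le> (1 / w) powr (3/4)"
proof -
  have "w * (2 - w) \<le> 3/4"
    using power_mono [of "1/2" "1 - w" 2] w by (simp add: power2_eq_square algebra_simps)
  then have "(w * (2 - w)) ^ 3 \<le> (3/4) ^ 3"
    using w by (intro power_mono) auto
  then have "(w * (2 - w)) ^ 3 * (2 - w) \<le> (3/4) ^ 3 * 2"
    using w by (intro mult_mono) auto
  also have "\<dots> \<le> 1" by (simp add: power3_eq_cube)
  finally have "(2 - w) ^ 4 \<le> (1 / w) ^ 3"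
    using w by (simp add: power_mult_distrib power_divide field_simps eval_nat_numeral)
  also have "\<dots> = ((1 / w) powr (3/4)) ^ 4"
    using w by (simp add: powr_realpow [symmetric] powr_powr flip: powr_numeral)
  finally show ?thesis
    using power_mono_iff [of "2 - w" "(1 / w) powr (3/4)" 4] w by simp
qed

lemma powr_concave:
  fixes p :: real
  assumes "0 \<le> p" "p \<le> 1"
  shows "concave_on {0<..} (\<lambda>x. x powr p)"
proof (rule f''_le0_imp_concave)
  fix x :: real assume x: "x \<in> {0<..}"
  show "((\<lambda>x. x powr p) has_real_derivative p * x powr (p - 1)) (at x)"
    using x by (auto intro!: derivative_eq_intros)
  show "((\<lambda>x. p * x powr (p - 1)) has_real_derivative p * ((p - 1) * x powr (p - 2))) (at x)"
    using x by (auto intro!: derivative_eq_intros)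
  show "p * ((p - 1) * x powr (p - 2)) \<le> 0"
    using assms by (intro mult_nonneg_nonpos mult_nonpos_nonneg) auto
qed simp

text \<open>
  The left-hand side without \<open>ln\<close> is affine in \<open>t\<close> and \<open>t powr (3/4)\<close> is concave, so it suffices to compare
  them at the end points \<open>1\<close> and \<open>1 / w\<close>.
\<close>

lemma ln_mix_le:
  fixes w t :: real
  assumes w: "0 < w" "w \<le> 1/2" and t: "1 \<le> t" "t \<le> 1 / w"
  shows "ln (w * t + (1 - w)) \<le> 3/4 * ln t"
proof -
  define x where "x = (t - 1) / (1 / w - 1)"
  have "1 / w > 1" using w by simp
  then have x: "0 \<le> x" "x \<le> 1" "x * (1 / w - 1) = t - 1"
    using t w unfolding x_def by (simp_all add: divide_le_eq)
  then have xt: "t = (1 - x) * 1 + x * (1 / w)"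
    by (simp add: right_diff_distrib)
  have "w * t + (1 - w) = (1 - x) * 1 + x * (2 - w)"
    using w by (simp add: xt algebra_simps)
  also have "\<dots> \<le> (1 - x) * 1 powr (3/4) + x * (1 / w) powr (3/4)"
    using mix_at_inverse_le [OF w] x by (simp add: mult_left_mono)
  also have "\<dots> \<le> ((1 - x) * 1 + x * (1 / w)) powr (3/4)"
    using concave_onD [OF powr_concave [of "3/4"], of x 1 "1 / w"] x w by simp
  also have "\<dots> = t powr (3/4)"
    using xt by simp
  finally have "ln (w * t + (1 - w)) \<le> ln (t powr (3/4))"
    using mix_pos [of w t] w t by (intro ln_mono) auto
  then show ?thesis
    using t by (simp add: ln_powr)
qed

text \<open>Up to \<open>1 / w\<close> this restates \<open>ln_mix_le\<close>. Beyond that point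
  \<open>t / m\<close> is still increasing in \<open>t\<close>, so the value at \<open>1 / w\<close>
  is a lower bound.\<close>

lemma ln_ratio_ge:
  fixes w t :: real
  assumes w: "0 < w" "w \<le> 1/2" and t: "1 \<le> t"
  shows "min (ln t) (ln (1 / w)) / 4 \<le> ln (t / (w * t + (1 - w)))"
proof (cases "t \<le> 1 / w")
  case True
  have "w * t + (1 - w) > 0" using mix_pos w t by simp
  then show ?thesis
    using ln_mix_le [OF w t True] t by (simp add: ln_div)
next
  case False
  have w1: "1 \<le> 1 / w" using w by simp
  have "ln (1 / w) / 4 \<le> ln ((1 / w) / (w * (1 / w) + (1 - w)))"
  proof -
    have "ln (1 / w) / 4 \<le> ln (1 / w) - ln (w * (1 / w) + (1 - w))"
      using ln_mix_le [OF w w1] by linarith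
    also have "\<dots> = ln ((1 / w) / (w * (1 / w) + (1 - w)))"
      using w mix_pos [of w "1 / w"] by (subst ln_div) auto
    finally show ?thesis .
  qed
  also have "\<dots> \<le> ln (t / (w * t + (1 - w)))"
  proof (rule ln_mono)
    \<comment> \<open>Cross-multiplied, this is
      \<open>(1 - w) * (t * w - 1) \<ge> 0\<close>.\<close>
    show "(1 / w) / (w * (1 / w) + (1 - w)) \<le> t / (w * t + (1 - w))"
      using False w t mix_pos [of w t] mult_nonneg_nonneg [of "1 - w" "t * w - 1"]
      by (simp add: field_simps)
  qed (use w in auto)
  finally show ?thesis by simp
qed

text \<open>The constant 4 is the one from \<open>ln_ratio_ge\<close>, which governs
  \<open>t > 1\<close>; the condition on \<open>l\<close> turns \<open>l * ln t\<close> into at most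
  \<open>ln t / ln (1 / w)\<close>.\<close>

lemma hell_term_le_js_term_aux:
  assumes w: "0 < w" "w \<le> 1/2" and l: "0 < l" "l < 1" "l * ln (1 / w) \<le> 1" and t: "t > 0"
  shows "hell_term l t 1 \<le> 4 / (w * ln (1 / w)) * js_term w t 1"
proof -
  let ?L = "ln (1 / w)"
  have L: "?L > 0" using w by simp
  have lL: "l \<le> 1 / ?L" using l L by (simp add: field_simps)
  show ?thesis
  proof (cases "t \<le> 1")
    case True
    let ?k = "1 - t + t * ln t"
    have "ln (1 / t) \<le> 1 / t - 1"
      using t by (intro ln_le_minus_one) auto
    then have "t * ln (1 / t) \<le> t * (1 / t - 1)"
      using t by (intro mult_left_mono) auto
    then have k: "?k \<ge> 0"
      using t by (simp add: ln_div algebra_simps)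
    have "hell_term l t 1 \<le> l * ?k"
      by (rule hell_term_le [OF t])
    \<comment> \<open>The bound \<open>1 / ?L\<close> is doubled so that, with the factor
      \<open>w / 2\<close> of \<open>js_term_ge_left\<close>, the constant agrees with the case
      \<open>t > 1\<close>.\<close>
    also have "\<dots> \<le> 2 / ?L * ?k"
    proof (intro mult_right_mono k)
      show "l \<le> 2 / ?L"
        using lL divide_right_mono [of 1 2 ?L] L by linarith
    qed
    also have "\<dots> = 4 / (w * ?L) * (w / 2 * ?k)"
    proof -
      have "2 / ?L = 4 / (w * ?L) * (w / 2)"
        using w by simp
      then show ?thesis by (simp only: mult.assoc)
    qed
    also have "\<dots> \<le> 4 / (w * ?L) * js_term w t 1"
      using js_term_ge_left [OF w t True] w L by (intro mult_left_mono) auto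
    finally show ?thesis .
  next
    case False
    let ?K = "4 / (w * ?L)"
    let ?F = "\<lambda>t. ?K * js_term w t 1 - hell_term l t 1"
    let ?F' = "\<lambda>t. ?K * (w * ln (t / (w * t + (1 - w)))) - (1 - l) * (1 - t powr - l)"
    have deriv: "(?F has_real_derivative ?F' s) (at s)" if "s > 0" for s
      using w that by (intro DERIV_diff DERIV_cmult hell_term_deriv js_term_deriv) auto
    then obtain z where z: "1 < z" "z < t" "?F t - ?F 1 = (t - 1) * ?F' z"
      using MVT2 [of 1 t ?F ?F'] False by force
    have pz: "z powr - l \<le> 1"
      using z l powr_mono2' [of "-l" 1 z] by simp
    have "(1 - l) * (1 - z powr - l) \<le> 1 * (1 - z powr - l)"
      using l pz by (intro mult_right_mono) auto
    \<comment> \<open>The expression is at most \<open>ln z / ?L\<close> by the choice of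
      \<open>l\<close>, and at most \<open>1\<close> trivially.\<close>
    also have "\<dots> \<le> min (ln z) ?L / ?L"
    proof -
      have "1 - z powr - l \<le> l * ln z"
        using one_minus_powr_bounds z by simp
      also have "\<dots> \<le> 1 / ?L * ln z"
        using lL z by (intro mult_right_mono) auto
      finally show ?thesis
        using L by (simp add: min_def)
    qed
    also have "\<dots> = ?K * (w * (min (ln z) ?L / 4))"
      using w by simp
    also have "\<dots> \<le> ?K * (w * ln (z / (w * z + (1 - w))))"
      using ln_ratio_ge [OF w, of z] z w L by (intro mult_left_mono) auto
    finally have "?F' z \<ge> 0" by simp
    then have "?F t - ?F 1 \<ge> 0"
      using z by simp
    then show ?thesis
      by (simp add: js_term_def hell_term_def)
  qed
qed

lemma hell_term_le_js_term:
  assumes w: "0 < w" "w \<le> 1/2" and l: "0 < l" "l < 1" "l * ln (1 / w) \<le> 1"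
    and ab: "a \<ge> 0" "b \<ge> 0"
  shows "hell_term l a b \<le> 4 / (w * ln (1 / w)) * js_term w a b"
proof -
  let ?L = "ln (1 / w)"
  have L: "?L > 0" using w by simp
  consider "a > 0" "b > 0" | "a = 0" | "b = 0" "a > 0"
    using ab by force
  then show ?thesis
  proof cases
    case 1
    have "hell_term l a b = b * hell_term l (a / b) 1"
      using hell_term_scale [of b "a / b" 1 l] 1 by simp
    also have "\<dots> \<le> b * (4 / (w * ?L) * js_term w (a / b) 1)"
      using 1 by (intro mult_left_mono hell_term_le_js_term_aux w l) auto
    also have "\<dots> = 4 / (w * ?L) * js_term w a b"
      using js_term_scale [of b w "a / b" 1] 1 by simp
    finally show ?thesis .
  next
    case 2
    have js: "js_term w 0 b = b * ((1 - w) * ln (1 / (1 - w)))"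
      by (cases "b = 0") (simp_all add: js_term_def)
    have "ln (1 - w) \<le> - w"
      using ln_le_minus_one [of "1 - w"] w by simp
    \<comment> \<open>Here \<open>1 - w \<ge> 1/2\<close> and \<open>- ln (1 - w) \<ge> w\<close>.
      Multiplied by \<open>4 / (w * ?L)\<close> this gives \<open>2 / ?L\<close>, which exceeds
      \<open>l\<close>.\<close>
    then have "w / 2 \<le> (1 - w) * ln (1 / (1 - w))"
      using w mult_mono [of "1/2" "1 - w" w "- ln (1 - w)"] by (simp add: ln_div)
    then have "4 / (w * ?L) * (w / 2) \<le> 4 / (w * ?L) * ((1 - w) * ln (1 / (1 - w)))"
      using w L by (intro mult_left_mono) auto
    moreover have "l \<le> 4 / (w * ?L) * (w / 2)"
      using l L w by (simp add: field_simps)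
    ultimately have "b * l \<le> b * (4 / (w * ?L) * ((1 - w) * ln (1 / (1 - w))))"
      using ab by (intro mult_left_mono) auto
    then show ?thesis
      using 2 js by (simp add: hell_term_def mult_ac)
  next
    case 3
    then have "hell_term l a b \<le> 4 * a"
      using l by (simp add: hell_term_def)
    also have "4 * a = 4 / (w * ?L) * js_term w a b"
      using 3 w L by (simp add: js_term_def)
    finally show ?thesis .
  qed
qed

section \<open>Summation over the domain\<close>

lemma pmf_summable_on: "pmf p summable_on A"
  using abs_summable_equivalent abs_summable_summable pmf_abs_summable by blast

lemma pmf_has_sum_1: "(pmf p has_sum 1) UNIV"
  using pmf_summable_on [of p UNIV] infsetsum_infsum [OF pmf_abs_summable [of p UNIV]]
    infsetsum_pmf_eq_1 [of p UNIV] by (simp add: has_sum_iff)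

text \<open>A bounded ratio gives the upper bound \<open>ln c * pmf p i\<close>, and
  \<open>ln x \<le> x - 1\<close> gives the lower bound \<open>pmf p i - pmf m i\<close>; both are
  summable.\<close>

lemma KL_terms_summable_on:
  assumes "c \<ge> 1" "\<And>i. pmf p i \<le> c * pmf m i"
  shows "(\<lambda>i. pmf p i * ln (pmf p i / pmf m i)) summable_on UNIV"
proof -
  have bound: "\<bar>pmf p i * ln (pmf p i / pmf m i)\<bar> \<le> ln c * pmf p i + pmf m i" for i
  proof (cases "pmf p i = 0")
    case False
    then have p: "pmf p i > 0"
      by (simp add: order_less_le)
    then have m: "pmf m i > 0"
      using assms(2) [of i] \<open>c \<ge> 1\<close> by (smt (verit) zero_less_mult_iff)
    have "ln (pmf p i / pmf m i) \<le> ln c"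
      using p m assms by (intro ln_mono) (auto simp: field_simps)
    then have up: "pmf p i * ln (pmf p i / pmf m i) \<le> pmf p i * ln c"
      using p by (intro mult_left_mono) auto
    have "ln (pmf m i / pmf p i) \<le> pmf m i / pmf p i - 1"
      using p m by (intro ln_le_minus_one) auto
    then have "pmf p i * ln (pmf m i / pmf p i) \<le> pmf p i * (pmf m i / pmf p i - 1)"
      using p by (intro mult_left_mono) auto
    also have "\<dots> = pmf m i - pmf p i"
      using p by (simp add: algebra_simps)
    finally have "pmf p i * ln (pmf p i / pmf m i) \<ge> pmf p i - pmf m i"
      using p m by (simp add: ln_div algebra_simps)
    moreover have "pmf p i * ln c \<ge> 0"
      using \<open>c \<ge> 1\<close> by simp
    ultimately show ?thesis
      using up p m unfolding mult.commute [of "ln c"] by (intro abs_leI) linarith+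
  qed simp
  have "(\<lambda>i. ln c * pmf p i + pmf m i) summable_on UNIV"
    by (intro summable_on_add summable_on_cmult_right pmf_summable_on)
  then have "(\<lambda>i. norm (pmf p i * ln (pmf p i / pmf m i))) summable_on UNIV"
    by (rule summable_on_comparison_test) (use bound in auto)
  then show ?thesis
    by (rule abs_summable_summable)
qed

lemma KL_eq_infsum:
  assumes "c \<ge> 1" "\<And>i. pmf p i \<le> c * pmf m i"
  shows "KL p m = ereal (\<Sum>\<^sub>\<infinity>i. pmf p i * ln (pmf p i / pmf m i))"
proof -
  have "set_pmf p \<subseteq> set_pmf m"
    using assms(2) by (auto simp: set_pmf_iff) (metis mult_zero_right order_antisym pmf_nonneg)
  then show ?thesis
    using KL_terms_summable_on [OF assms] by (simp add: KL_def)
qed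

text \<open>The mixture dominates \<open>w * p\<close> and \<open>(1 - w) * q\<close>, so both
  ratios are bounded and both \<open>KL\<close> values are finite sums.\<close>

lemma JS_has_sum:
  assumes w: "0 < w" "w < 1"
  obtains S where "((\<lambda>i. js_term w (pmf p i) (pmf q i)) has_sum S) UNIV" "JS w p q = ereal S"
proof -
  let ?m = "mix_pmf w p q"
  have m: "pmf ?m i = w * pmf p i + (1 - w) * pmf q i" for i
    using w by (simp add: pmf_mix_pmf)
  have p: "1 \<le> 1 / w" "pmf p i \<le> 1 / w * pmf ?m i" for i
    using w mult_nonneg_nonneg [of "1 - w" "pmf q i"] by (simp_all add: m field_simps)
  have q: "1 \<le> 1 / (1 - w)" "pmf q i \<le> 1 / (1 - w) * pmf ?m i" for i
    using w mult_nonneg_nonneg [of w "pmf p i"] by (simp_all add: m field_simps)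
  let ?S = "w * (\<Sum>\<^sub>\<infinity>i. pmf p i * ln (pmf p i / pmf ?m i)) +
            (1 - w) * (\<Sum>\<^sub>\<infinity>i. pmf q i * ln (pmf q i / pmf ?m i))"
  have "((\<lambda>i. w * (pmf p i * ln (pmf p i / pmf ?m i)) +
          (1 - w) * (pmf q i * ln (pmf q i / pmf ?m i))) has_sum ?S) UNIV"
    by (intro has_sum_add has_sum_cmult_right has_sum_infsum KL_terms_summable_on [OF p]
        KL_terms_summable_on [OF q])
  then have "((\<lambda>i. js_term w (pmf p i) (pmf q i)) has_sum ?S) UNIV"
    by (simp add: js_term_def m)
  moreover have "JS w p q = ereal ?S"
    by (simp add: JS_def KL_eq_infsum [OF p] KL_eq_infsum [OF q])
  ultimately show ?thesis
    by (rule that)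
qed

text \<open>The linear parts sum to \<open>(1 - l) + l = 1\<close> and, by
  \<open>hell_term_nonneg\<close>, majorize the products, which are therefore summable.\<close>

lemma Hell_has_sum:
  assumes l: "0 < l" "l < 1"
  shows "((\<lambda>i. hell_term l (pmf p i) (pmf q i)) has_sum Hell (1 - l) p q) UNIV"
proof -
  have lin: "((\<lambda>i. (1 - l) * pmf p i + l * pmf q i) has_sum ((1 - l) * 1 + l * 1)) UNIV"
    by (intro has_sum_add has_sum_cmult_right pmf_has_sum_1)
  have "(\<lambda>i. pmf p i powr (1 - l) * pmf q i powr l) summable_on UNIV"
  proof (rule summable_on_comparison_test)
    show "(\<lambda>i. (1 - l) * pmf p i + l * pmf q i) summable_on UNIV"
      using lin by (rule has_sum_imp_summable)
    show "pmf p i powr (1 - l) * pmf q i powr l \<le> (1 - l) * pmf p i + l * pmf q i" for i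
      using hell_term_nonneg [of l "pmf p i" "pmf q i"] l by (simp add: hell_term_def)
  qed simp
  then have "((\<lambda>i. pmf p i powr (1 - l) * pmf q i powr l) has_sum (1 - Hell (1 - l) p q)) UNIV"
    by (simp add: Hell_def)
  from has_sum_add [OF lin has_sum_cmult_right [OF this, of "-1"]] show ?thesis
    by (simp add: hell_term_def)
qed

section \<open>Ceilings and the numerical constants\<close>

lemma ereal_ceiling_mono:
  fixes x y :: real
  assumes "x \<le> y"
  shows "ereal_ceiling (ereal x) \<le> ereal_ceiling (ereal y)"
  using assms by (simp add: ereal_ceiling_def ceiling_mono)

theorem lemma7p4:
  fixes p q :: "'a pmf" and \<pi> :: real
  assumes "0 < \<pi>" and "\<pi> \<le> 1/2"
  shows "(\<forall>l::real. 0 < l \<and> l \<le> 1/2 \<longrightarrow>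
            JS \<pi> p q \<le> ereal (32 * exp (2 * l * ln (1/\<pi>)) * \<pi> / l * Hell (1 - l) p q)) \<and>
         (let l = (1/2) * ln 2 / ln (1/\<pi>) in
            ereal_ceiling (ereal (3/16) * (ereal (\<pi> * ln (1/\<pi>)) / JS \<pi> p q))
              \<le> ereal_ceiling (2 / ereal (Hell (1 - l) p q)) \<and>
            ereal_ceiling (2 / ereal (Hell (1 - l) p q))
              \<le> ereal_ceiling (ereal (256 / ln 2) * (ereal (\<pi> * ln (1/\<pi>)) / JS \<pi> p q)))"
proof -
  let ?L = "ln (1 / \<pi>)"
  have \<pi>: "0 < \<pi>" "\<pi> < 1" and L: "?L > 0"
    using assms by simp_all
  obtain S where S: "((\<lambda>i. js_term \<pi> (pmf p i) (pmf q i)) has_sum S) UNIV" "JS \<pi> p q = ereal S"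
    using JS_has_sum [OF \<pi>] .
  have upper: "S \<le> 32 * exp (2 * l * ?L) * \<pi> / l * Hell (1 - l) p q" if l: "0 < l" "l \<le> 1/2" for l
  proof -
    have l1: "l < 1" using l by simp
    have "S \<le> 2 * \<pi> powr - l * \<pi> / l * Hell (1 - l) p q"
      by (rule has_sum_mono [OF S(1) has_sum_cmult_right [OF Hell_has_sum [OF l(1) l1]]])
        (intro js_term_le_hell_term \<pi> l pmf_nonneg)
    \<comment> \<open>The factor 2 is enlarged to 32, and
      \<open>\<pi> powr - l = exp (l * ?L)\<close> to \<open>exp (2 * l * ?L)\<close>.\<close>
    also have "\<dots> \<le> 32 * exp (2 * l * ?L) * \<pi> / l * Hell (1 - l) p q"
    proof (intro mult_right_mono divide_right_mono mult_mono)
      have "\<pi> powr - l = exp (l * ?L)"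
        using \<pi> by (simp add: powr_def ln_div)
      also have "\<dots> \<le> exp (2 * l * ?L)"
        using l L by simp
      finally show "\<pi> powr - l \<le> exp (2 * l * ?L)" .
      show "Hell (1 - l) p q \<ge> 0"
        by (rule has_sum_nonneg [OF Hell_has_sum [OF l(1) l1]])
          (use l in \<open>auto intro!: hell_term_nonneg\<close>)
    qed (use \<pi> l in auto)
    finally show ?thesis .
  qed
  define l where "l = (1/2) * ln 2 / ?L"
  define H where "H = Hell (1 - l) p q"
  have "ln 2 \<le> ?L"
    using assms by (intro ln_mono) (auto simp: field_simps)
  then have l: "0 < l" "l \<le> 1/2" "l < 1"
    unfolding l_def using L by (auto simp: field_simps)
  have lL: "l * ?L = ln 2 / 2"
    unfolding l_def using L by simp
  have H0: "H \<ge> 0"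
    unfolding H_def by (rule has_sum_nonneg [OF Hell_has_sum [OF l(1,3)]])
      (use l in \<open>auto intro!: hell_term_nonneg\<close>)
  have HS: "H \<le> 4 / (\<pi> * ?L) * S"
    unfolding H_def
  proof (rule has_sum_mono [OF Hell_has_sum [OF l(1,3)] has_sum_cmult_right [OF S(1)]])
    have "l * ?L \<le> 1"
      unfolding lL using ln_le_minus_one [of 2] by simp
    then show "hell_term l (pmf p i) (pmf q i) \<le> 4 / (\<pi> * ?L) * js_term \<pi> (pmf p i) (pmf q i)" for i
      using assms l by (intro hell_term_le_js_term) auto
  qed
  \<comment> \<open>This \<open>l\<close> makes the exponential equal to 2, and
    \<open>1 / l = 2 * ?L / ln 2\<close>; hence \<open>32 * 2 * 2 = 128\<close>.\<close>
  have SH: "S \<le> 128 * (\<pi> * ?L) / ln 2 * H"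
  proof -
    have "2 * l * ?L = ln 2"
      using lL by linarith
    then have "exp (2 * l * ?L) = 2"
      by simp
    moreover have "32 * 2 * \<pi> / l = 128 * (\<pi> * ?L) / ln 2"
      unfolding l_def using L by simp
    ultimately show ?thesis
      using upper [OF l(1,2)] unfolding H_def by metis
  qed
  have pL: "\<pi> * ?L > 0" using \<pi> L by simp
  have ceil: "ereal_ceiling (ereal (3/16) * (ereal (\<pi> * ?L) / ereal S)) \<le> ereal_ceiling (2 / ereal H) \<and>
      ereal_ceiling (2 / ereal H) \<le> ereal_ceiling (ereal (256 / ln 2) * (ereal (\<pi> * ?L) / ereal S))"
  proof (cases "S > 0")
    \<comment> \<open>Here \<open>S = H = 0\<close>, so every quotient is a positive number divided
      by zero and all the ceilings equal \<open>\<infinity>\<close>.\<close>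
    case False
    have "4 / (\<pi> * ?L) > 0" using pL by simp
    then have "S \<ge> 0"
      using HS H0 by (smt (verit) zero_le_mult_iff)
    then have "S = 0" "H = 0"
      using False HS H0 by auto
    then show ?thesis
      using \<pi> L by (auto simp: ereal_ceiling_def divide_ereal_def)
  next
    case True
    have H: "H > 0"
      using SH H0 True by (cases "H = 0") auto
    \<comment> \<open>\<open>HS\<close> gives this even with \<open>1/2\<close> in place of
      \<open>3/16\<close>. The opposite bound is \<open>SH\<close>, with
      \<open>256 = 2 * 128\<close>.\<close>
    have "3/16 * (\<pi> * ?L / S) \<le> 2 / H"
    proof -
      have "H * (\<pi> * ?L) \<le> 4 * S"
        using HS pL by (simp add: field_simps)
      then have "3 * (H * (\<pi> * ?L)) \<le> 32 * S"
        using True by linarith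
      then show ?thesis
        using True H by (simp add: field_simps)
    qed
    moreover have "2 / H \<le> 256 / ln 2 * (\<pi> * ?L / S)"
      using SH True H by (simp add: field_simps)
    ultimately show ?thesis
      using ereal_ceiling_mono True H by simp
  qed
  show ?thesis
    using upper ceil unfolding Let_def S(2) H_def l_def by simp
qed

end
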